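(* Let $A$ be a real $n_x\times n_x$ matrix and $B_2$ a real $n_x\times n_u$ matrix, and let $\mathbf{Z}_{AB}=\begin{bmatrix} zI-A & -B_2\end{bmatrix}$. Let $\mathcal{c}_j\subseteq\{1,\dots,n_x\}$ be nonempty, let $\mathcal{L}$ be a locality constraint on $(n_x+n_u)\times n_x$ transfer matrices, let $T$ be a nonnegative integer, let $g_j$ be a functional on, and $\mathcal{X}_j$ a set of, $(n_x+n_u)\times|\mathcal{c}_j|$ transfer matrices. Let the index sets $\mathcal{s}_j,\mathcal{t}_j$ and the restrictions $\bar g_j,\bar{\mathcal{X}}_j$ be as defined in the context. Then the problem $$\begin{aligned}\underset{\mathbf{\Phi}(:,\mathcal{c}_j)}{\text{minimize}}\quad & g_j(\mathbf{\Phi}(:,\mathcal{c}_j))\\ \text{subject to}\quad & \mathbf{Z}_{AB}\,\mathbf{\Phi}(:,\mathcal{c}_j)=I(:,\mathcal{c}_j),\\ & \mathbf{\Phi}(:,\mathcal{c}_j)\in\mathcal{L}(:,\mathcal{c}_j)\cap\mathcal{F}_T\cap\mathcal{X}_j\end{aligned}$$ is equivalent to the reduced problem $$\begin{aligned}\underset{\mathbf{\Phi}(\mathcal{s}_j,\mathcal{c}_j)}{\text{minimize}}\quad & \bar g_j(\mathbf{\Phi}(\mathcal{s}_j,\mathcal{c}_j))\\ \text{subject to}\quad & \mathbf{Z}_{AB}(\mathcal{t}_j,\mathcal{s}_j)\,\mathbf{\Phi}(\mathcal{s}_j,\mathcal{c}_j)=I(\mathcal{t}_j,\mathcal{c}_j),\\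 & \mathbf{\Phi}(\mathcal{s}_j,\mathcal{c}_j)\in\mathcal{L}(\mathcal{s}_j,\mathcal{c}_j)\cap\mathcal{F}_T\cap\bar{\mathcal{X}}_j.\end{aligned}$$ That is, the map $\mathbf{\Phi}(:,\mathcal{c}_j)\mapsto\mathbf{\Phi}(\mathcal{s}_j,\mathcal{c}_j)$ is a bijection from the feasible set of the first problem onto the feasible set of the second which preserves the objective value (so the two problems have the same optimal value and corresponding optimal solutions).
   Context: For a transfer matrix (or constant matrix) $\mathbf{G}$ and index sets $\mathcal{r},\mathcal{c}$, $\mathbf{G}(\mathcal{r},\mathcal{c})$ is the submatrix with rows in $\mathcal{r}$ and columns in $\mathcal{c}$; the symbol $:$ means all rows or all columns. $I$ is the $n_x\times n_x$ identity matrix and $z$ is the transform variable. $\mathcal{F}_T$ is the set of finite impulse response transfer matrices of horizon $T$, i.e. those of the form $\sum_{i=0}^T z^{-i}G[i]$ with real matrices $G[i]$ (of whatever size the context requires). A locality constraint $\mathcal{L}$ is a collection of sparsity constraints: it is given by a set of index pairs $(i,k)$, and $\mathbf{\Phi}\in\mathcal{L}$ means $\mathbf{\Phi}_{ik}=0$ for all these pairs. $\mathcal{L}(\mathcal{r},\mathcal{c})$ denotes the sparsity constraints imposed by $\mathcal{L}$ on the submatrix $\mathbf{\Phi}(\mathcal{r},\mathcal{c})$. Index sets: $\bar{\mathcal{s}}_j$ is the largest subset of $\{1,\dots,n_x+n_u\}$ such that $\mathcal{L}(\bar{\mathcal{s}}_j,\mathcal{c}_j)$ forces every entry of $\mathbf{\Phi}(\bar{\mathcal{s}}_j,\mathcal{c}_j)$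 to be zero, and $\mathcal{s}_j=\{1,\dots,n_x+n_u\}\setminus\bar{\mathcal{s}}_j$. $\bar{\mathcal{t}}_j$ is the largest subset of $\{1,\dots,n_x\}$ such that the augmented matrix $\begin{bmatrix}\mathbf{Z}_{AB}(\bar{\mathcal{t}}_j,\mathcal{s}_j) & I(\bar{\mathcal{t}}_j,\mathcal{c}_j)\end{bmatrix}$ is zero, and $\mathcal{t}_j=\{1,\dots,n_x\}\setminus\bar{\mathcal{t}}_j$. Restrictions: $\bar g_j$ and $\bar{\mathcal{X}}_j$ are the restrictions of $g_j$ and $\mathcal{X}_j$ to the subspace $\mathbf{\Phi}(\bar{\mathcal{s}}_j,\mathcal{c}_j)=0$. Explicitly, for a $|\mathcal{s}_j|\times|\mathcal{c}_j|$ transfer matrix $\mathbf{\Theta}$ let $E(\mathbf{\Theta})$ be the $(n_x+n_u)\times|\mathcal{c}_j|$ transfer matrix whose rows in $\mathcal{s}_j$ form $\mathbf{\Theta}$ and whose rows in $\bar{\mathcal{s}}_j$ are zero; then $\bar g_j(\mathbf{\Theta})=g_j(E(\mathbf{\Theta}))$, and $\mathbf{\Theta}\in\bar{\mathcal{X}}_j$ if and only if $E(\mathbf{\Theta})\in\mathcal{X}_j$. *)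

theory Defs
  imports
    "Jordan_Normal_Form.DL_Submatrix"
    "HOL-Computational_Algebra.Polynomial"
    "HOL-Computational_Algebra.Fraction_Field"
    "HOL-Library.Extended_Real"
begin

text \<open>
  Transfer functions are real rational functions in \<open>z\<close>. Rows and columns are numbered from 0,
  so \<open>{1,\<dots>,n}\<close> becomes \<open>{..<n}\<close>. The submatrix \<open>G(r,c)\<close> is \<^const>\<open>submatrix\<close> \<open>G r c\<close>, whose
  rows and columns are renumbered in increasing order; the symbol ``:'' is \<^const>\<open>UNIV\<close>.
\<close>

type_synonym tfun = "real poly fract"

definition const_tf :: "real \<Rightarrow> tfun" where
  "const_tf a = Fract [:a:] 1"

definition z_tf :: tfun where
  "z_tf = Fract [:0, 1:] 1"

definition append_cols :: "'a::zero mat \<Rightarrow> 'a mat \<Rightarrow> 'a mat" where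
  "append_cols M N = four_block_mat M N (0\<^sub>m 0 (dim_col M)) (0\<^sub>m 0 (dim_col N))"

definition Z_AB :: "nat \<Rightarrow> real mat \<Rightarrow> real mat \<Rightarrow> tfun mat" where
  "Z_AB nx A B2 = append_cols (z_tf \<cdot>\<^sub>m 1\<^sub>m nx - map_mat const_tf A) (- map_mat const_tf B2)"

definition FIR :: "nat \<Rightarrow> nat \<Rightarrow> nat \<Rightarrow> tfun mat set" where
  "FIR m n T = {M. \<exists>G :: nat \<Rightarrow> real mat. (\<forall>i\<le>T. G i \<in> carrier_mat m n) \<and>
     M = mat m n (\<lambda>(r, k). \<Sum>i\<le>T. inverse z_tf ^ i * const_tf (G i $$ (r, k)))}"

definition sparse_mats :: "nat \<Rightarrow> nat \<Rightarrow> (nat \<times> nat) set \<Rightarrow> tfun mat set" where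
  "sparse_mats m n L = {M \<in> carrier_mat m n. \<forall>(i, k) \<in> L. M $$ (i, k) = 0}"

text \<open>
  The position of \<open>i \<in> r\<close> in the increasing enumeration of \<open>r\<close>, i.e. the index that row \<open>i\<close>
  receives in a submatrix with rows in \<open>r\<close> (it is inverse to \<^const>\<open>pick\<close> \<open>r\<close>).
\<close>

definition pos_in :: "nat set \<Rightarrow> nat \<Rightarrow> nat" where
  "pos_in r i = card {a \<in> r. a < i}"

text \<open>The constraints that \<open>L\<close> imposes on \<open>\<Phi>(r,c)\<close>, as index pairs of that submatrix.\<close>

definition sub_locality :: "(nat \<times> nat) set \<Rightarrow> nat set \<Rightarrow> nat set \<Rightarrow> (nat \<times> nat) set" where
  "sub_locality L r c = {(pos_in r i, pos_in c k) | i k. (i, k) \<in> L \<and> i \<in> r \<and> k \<in> c}"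

text \<open>In the next two definitions \<open>GREATEST\<close> refers to the inclusion order on sets.\<close>

definition s_bar :: "nat \<Rightarrow> nat \<Rightarrow> (nat \<times> nat) set \<Rightarrow> nat set \<Rightarrow> nat set" where
  "s_bar nx nu L c = (GREATEST S. S \<subseteq> {..<nx + nu} \<and>
     (\<forall>M \<in> sparse_mats (card S) (card c) (sub_locality L S c). M = 0\<^sub>m (card S) (card c)))"

definition s_set :: "nat \<Rightarrow> nat \<Rightarrow> (nat \<times> nat) set \<Rightarrow> nat set \<Rightarrow> nat set" where
  "s_set nx nu L c = {..<nx + nu} - s_bar nx nu L c"

definition t_bar :: "nat \<Rightarrow> real mat \<Rightarrow> real mat \<Rightarrow> nat set \<Rightarrow> nat set \<Rightarrow> nat set" where
  "t_bar nx A B2 s c = (GREATEST R. R \<subseteq> {..<nx} \<and>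
     append_cols (submatrix (Z_AB nx A B2) R s) (submatrix (1\<^sub>m nx) R c)
       = 0\<^sub>m (card R) (card s + card c))"

definition t_set :: "nat \<Rightarrow> real mat \<Rightarrow> real mat \<Rightarrow> nat set \<Rightarrow> nat set \<Rightarrow> nat set" where
  "t_set nx A B2 s c = {..<nx} - t_bar nx A B2 s c"

definition extend_rows :: "nat \<Rightarrow> nat set \<Rightarrow> tfun mat \<Rightarrow> tfun mat" where
  "extend_rows n s M = mat n (dim_col M) (\<lambda>(i, k). if i \<in> s then M $$ (pos_in s i, k) else 0)"

definition restrict_fun :: "nat \<Rightarrow> nat set \<Rightarrow> (tfun mat \<Rightarrow> ereal) \<Rightarrow> tfun mat \<Rightarrow> ereal" where
  "restrict_fun n s g M = g (extend_rows n s M)"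

definition restrict_set :: "nat \<Rightarrow> nat set \<Rightarrow> nat \<Rightarrow> tfun mat set \<Rightarrow> tfun mat set" where
  "restrict_set n s m X = {M \<in> carrier_mat (card s) m. extend_rows n s M \<in> X}"

definition feasible_full ::
  "nat \<Rightarrow> nat \<Rightarrow> real mat \<Rightarrow> real mat \<Rightarrow> nat set \<Rightarrow> (nat \<times> nat) set \<Rightarrow> nat \<Rightarrow> tfun mat set
    \<Rightarrow> tfun mat set" where
  "feasible_full nx nu A B2 c L T X =
    {\<Phi> \<in> carrier_mat (nx + nu) (card c).
       Z_AB nx A B2 * \<Phi> = submatrix (1\<^sub>m nx) UNIV c \<and>
       \<Phi> \<in> sparse_mats (nx + nu) (card c) (sub_locality L UNIV c)
           \<inter> FIR (nx + nu) (card c) T \<inter> X}"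

definition feasible_red ::
  "nat \<Rightarrow> real mat \<Rightarrow> real mat \<Rightarrow> nat set \<Rightarrow> nat set \<Rightarrow> nat set \<Rightarrow> (nat \<times> nat) set \<Rightarrow> nat
    \<Rightarrow> tfun mat set \<Rightarrow> tfun mat set" where
  "feasible_red nx A B2 s t c L T X' =
    {\<Theta> \<in> carrier_mat (card s) (card c).
       submatrix (Z_AB nx A B2) t s * \<Theta> = submatrix (1\<^sub>m nx) t c \<and>
       \<Theta> \<in> sparse_mats (card s) (card c) (sub_locality L s c)
           \<inter> FIR (card s) (card c) T \<inter> X'}"

definition opt_value :: "('a \<Rightarrow> ereal) \<Rightarrow> 'a set \<Rightarrow> ereal" where
  "opt_value g F = (INF x\<in>F. g x)"

definition opt_solutions :: "('a \<Rightarrow> ereal) \<Rightarrow> 'a set \<Rightarrow> 'a set" where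
  "opt_solutions g F = {x \<in> F. \<forall>y\<in>F. g x \<le> g y}"

end

theory Submission
  imports Defs
begin

text \<open>
  The locality constraint makes the rows of \<open>\<Phi>(:,c)\<close> outside \<open>s\<close> vanish. On the subspace of
  matrices with this property, \<open>\<Phi> \<mapsto> \<Phi>(s,:)\<close> and the zero extension \<open>extend_rows\<close> are inverse
  to each other, so it is enough to show that such a \<open>\<Phi>\<close> is feasible iff \<open>\<Phi>(s,:)\<close> is feasible for
  the reduced problem (\<open>feasible_full_iff_red\<close>).

  Locality, finite impulse response and membership in \<open>X\<close> are compared entry by entry: a zero row
  satisfies the first two trivially. For the affine constraint, the product \<open>Z\<^sub>A\<^sub>B \<Phi>\<close> only sees the
  columns of \<open>Z\<^sub>A\<^sub>B\<close> in \<open>s\<close>, so its rows in \<open>t\<close> are those of \<open>Z\<^sub>A\<^sub>B(t,s) \<Phi>(s,:)\<close>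
  (\<open>index_mult_submatrix\<close>), and in the rows outside \<open>t\<close> the equation reads \<open>0 = 0\<close>.

  For these arguments the index sets are needed in explicit form. A row set \<open>S\<close> qualifies for
  \<open>s_bar\<close> or \<open>t_bar\<close> iff each single row in it qualifies; hence a greatest such set exists and it
  consists of all the qualifying rows (\<open>Greatest_rowwise\<close>).
\<close>

section \<open>Positions in increasing enumerations\<close>

lemma pos_in_UNIV [simp]: "pos_in UNIV i = i"
  by (simp add: pos_in_def flip: lessThan_def)

lemma pos_in_less_card: "finite r \<Longrightarrow> i \<in> r \<Longrightarrow> pos_in r i < card r"
  unfolding pos_in_def by (rule psubset_card_mono) auto

lemma pick_pos_in: "i \<in> r \<Longrightarrow> pick r (pos_in r i) = i"
  unfolding pos_in_def by (rule pick_card_in_set)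

lemma pos_in_pick: "a < card r \<Longrightarrow> pos_in r (pick r a) = a"
  unfolding pos_in_def by (rule card_pick) simp

lemma pos_in_inject: "i \<in> r \<Longrightarrow> j \<in> r \<Longrightarrow> pos_in r i = pos_in r j \<longleftrightarrow> i = j"
  by (metis pick_pos_in)

lemma bij_betw_pos_in:
  assumes "finite r"
  shows "bij_betw (pos_in r) r {0..<card r}"
proof (rule bij_betw_byWitness[where f' = "pick r"])
  show "pick r ` {0..<card r} \<subseteq> r"
    by (auto intro: pick_in_set_le)
qed (use assms in \<open>auto simp: pick_pos_in pos_in_pick pos_in_less_card\<close>)

lemma all_less_card_iff:
  assumes "finite r"
  shows "(\<forall>a<card r. P a) \<longleftrightarrow> (\<forall>i\<in>r. P (pos_in r i))"
  using bij_betw_imp_surj_on[OF bij_betw_pos_in[OF assms], symmetric]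
  by (metis (no_types, lifting) atLeast0LessThan imageE imageI lessThan_iff)

text \<open>
  Addressing a renumbered matrix by original indices keeps \<open>pick\<close> out of all later arguments.
\<close>

lemma mat_eq_iff_positions:
  assumes "finite r" "finite q" "M \<in> carrier_mat (card r) (card q)" "N \<in> carrier_mat (card r) (card q)"
  shows "M = N \<longleftrightarrow>
    (\<forall>i\<in>r. \<forall>k\<in>q. M $$ (pos_in r i, pos_in q k) = N $$ (pos_in r i, pos_in q k))"
proof -
  have "M = N \<longleftrightarrow> (\<forall>a<card r. \<forall>b<card q. M $$ (a, b) = N $$ (a, b))"
    using assms by auto
  then show ?thesis
    using assms by (simp add: all_less_card_iff)
qed

lemma mat_eq_iff_row_positions:
  assumes "finite r" "M \<in> carrier_mat (card r) m" "N \<in> carrier_mat (card r) m"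
  shows "M = N \<longleftrightarrow> (\<forall>i\<in>r. \<forall>l<m. M $$ (pos_in r i, l) = N $$ (pos_in r i, l))"
  using mat_eq_iff_positions[of r "{..<m}" M N] assms
  using all_less_card_iff[of "{..<m}"] by simp

lemma submatrix_carrier:
  assumes "A \<in> carrier_mat m n" "r \<subseteq> {..<m}" "q \<subseteq> {..<n}"
  shows "submatrix A r q \<in> carrier_mat (card r) (card q)"
proof -
  have "{i. i < m \<and> i \<in> r} = r" "{j. j < n \<and> j \<in> q} = q"
    using assms(2,3) by auto
  then show ?thesis
    using assms(1) by (intro carrier_matI) (simp_all add: dim_submatrix)
qed

lemma submatrix_UNIV_rows_carrier:
  assumes "A \<in> carrier_mat m n" "q \<subseteq> {..<n}"
  shows "submatrix A UNIV q \<in> carrier_mat m (card q)"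
proof -
  have "{j. j < n \<and> j \<in> q} = q"
    using assms(2) by auto
  then show ?thesis
    using assms(1) by (intro carrier_matI) (simp_all add: dim_submatrix)
qed

lemma submatrix_UNIV_cols_carrier:
  assumes "A \<in> carrier_mat m n" "r \<subseteq> {..<m}"
  shows "submatrix A r UNIV \<in> carrier_mat (card r) n"
proof -
  have "{j. j < m \<and> j \<in> r} = r"
    using assms(2) by auto
  then show ?thesis
    using assms(1) by (intro carrier_matI) (simp_all add: dim_submatrix)
qed

lemma index_submatrix_pos:
  assumes "A \<in> carrier_mat m n" "i < m" "j < n" "i \<in> r" "j \<in> q"
  shows "submatrix A r q $$ (pos_in r i, pos_in q j) = A $$ (i, j)"
  using assms unfolding pos_in_def by (auto intro: submatrix_index_card)

lemma index_submatrix_pos_UNIV: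
  assumes "A \<in> carrier_mat m n" "i < m" "l < n" "i \<in> r"
  shows "submatrix A r UNIV $$ (pos_in r i, l) = A $$ (i, l)"
  using index_submatrix_pos[OF assms, of UNIV] by simp

section \<open>The index sets in explicit form\<close>

lemma Greatest_rowwise:
  assumes "\<And>S. S \<subseteq> U \<Longrightarrow> P S \<longleftrightarrow> (\<forall>i\<in>S. Q i)"
  shows "(GREATEST S. S \<subseteq> U \<and> P S) = {i \<in> U. Q i}"
  by (rule Greatest_equality) (auto simp: assms)

lemma sparse_mats_sub_locality_iff:
  "M \<in> sparse_mats m n (sub_locality L r c) \<longleftrightarrow>
    M \<in> carrier_mat m n \<and>
    (\<forall>i\<in>r. \<forall>k\<in>c. (i, k) \<in> L \<longrightarrow> M $$ (pos_in r i, pos_in c k) = 0)"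
  unfolding sparse_mats_def sub_locality_def by fastforce

text \<open>
  Constraints force the zero matrix only if they list every entry: otherwise the matrix with ones
  at all the unlisted positions is a nonzero solution.
\<close>

lemma sparse_mats_trivial_iff:
  assumes "finite S" "finite c"
  shows "(\<forall>M \<in> sparse_mats (card S) (card c) (sub_locality L S c). M = 0\<^sub>m (card S) (card c))
    \<longleftrightarrow> (\<forall>i\<in>S. \<forall>k\<in>c. (i, k) \<in> L)" (is "?zero \<longleftrightarrow> ?all")
proof
  assume zero: ?zero
  define M :: "tfun mat" where "M = mat (card S) (card c)
    (\<lambda>p. if p \<in> sub_locality L S c then 0 else 1)"
  have less: "pos_in S i < card S" "pos_in c k < card c" if "i \<in> S" "k \<in> c" for i k
    using that assms by (simp_all add: pos_in_less_card)
  have "M \<in> sparse_mats (card S) (card c) (sub_locality L S c)"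
    unfolding sparse_mats_sub_locality_iff by (auto simp: M_def less sub_locality_def)
  with zero have M0: "M = 0\<^sub>m (card S) (card c)"
    by blast
  show ?all
  proof (intro ballI)
    fix i k assume ik: "i \<in> S" "k \<in> c"
    have "M $$ (pos_in S i, pos_in c k) = 0"
      using less[OF ik] M0 by simp
    then have "(pos_in S i, pos_in c k) \<in> sub_locality L S c"
      using less[OF ik] by (simp add: M_def split: if_splits)
    then show "(i, k) \<in> L"
      using ik by (auto simp: sub_locality_def pos_in_inject)
  qed
next
  assume ?all
  then show ?zero
    using assms by (auto simp: sparse_mats_sub_locality_iff mat_eq_iff_positions pos_in_less_card)
qed

lemma s_set_eq:
  assumes "finite c"
  shows "s_set nx nu L c = {i \<in> {..<nx + nu}. \<not> (\<forall>k\<in>c. (i, k) \<in> L)}"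
proof -
  have "s_bar nx nu L c = {i \<in> {..<nx + nu}. \<forall>k\<in>c. (i, k) \<in> L}"
    unfolding s_bar_def
    by (rule Greatest_rowwise) (simp add: sparse_mats_trivial_iff assms finite_subset)
  then show ?thesis
    unfolding s_set_def by auto
qed

lemma append_cols_eq_zero_iff:
  assumes "M \<in> carrier_mat m n" "N \<in> carrier_mat m p"
  shows "append_cols M N = 0\<^sub>m m (n + p) \<longleftrightarrow> M = 0\<^sub>m m n \<and> N = 0\<^sub>m m p" (is "?L \<longleftrightarrow> ?R")
proof
  assume L: ?L
  have "M $$ (i, j) = 0" if "i < m" "j < n" for i j
    using arg_cong[OF L, of "\<lambda>K. K $$ (i, j)"] that assms by (simp add: append_cols_def)
  moreover have "N $$ (i, j) = 0" if "i < m" "j < p" for i j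
    using arg_cong[OF L, of "\<lambda>K. K $$ (i, n + j)"] that assms by (simp add: append_cols_def)
  ultimately show ?R
    using assms by auto
next
  assume ?R
  then show ?L
    by (auto simp: append_cols_def)
qed

lemma Z_AB_carrier:
  assumes "A \<in> carrier_mat nx nx" "B2 \<in> carrier_mat nx nu"
  shows "Z_AB nx A B2 \<in> carrier_mat nx (nx + nu)"
  using assms by (auto simp: Z_AB_def append_cols_def)

lemma t_set_eq:
  assumes "A \<in> carrier_mat nx nx" "B2 \<in> carrier_mat nx nu"
    and s: "s \<subseteq> {..<nx + nu}" and c: "c \<subseteq> {..<nx}"
  shows "t_set nx A B2 s c = {i \<in> {..<nx}.
    \<not> ((\<forall>j\<in>s. Z_AB nx A B2 $$ (i, j) = 0) \<and> (\<forall>k\<in>c. 1\<^sub>m nx $$ (i, k) = (0::tfun)))}"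
proof -
  note Z = Z_AB_carrier[OF assms(1,2)]
  have "t_bar nx A B2 s c = {i \<in> {..<nx}.
    (\<forall>j\<in>s. Z_AB nx A B2 $$ (i, j) = 0) \<and> (\<forall>k\<in>c. 1\<^sub>m nx $$ (i, k) = (0::tfun))}"
    unfolding t_bar_def
  proof (rule Greatest_rowwise)
    fix R assume R: "R \<subseteq> {..<nx}"
    have finR: "finite R"
      using R finite_subset by auto
    have zero_iff: "submatrix M R q = 0\<^sub>m (card R) (card q) \<longleftrightarrow> (\<forall>i\<in>R. \<forall>j\<in>q. M $$ (i, j) = 0)"
      if M: "M \<in> carrier_mat nx n" and q: "q \<subseteq> {..<n}" for M :: "tfun mat" and n q
    proof -
      have "finite q"
        using q finite_subset by auto
      moreover have "submatrix M R q $$ (pos_in R i, pos_in q j) = M $$ (i, j)"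
        if "i \<in> R" "j \<in> q" for i j
        using that R q by (intro index_submatrix_pos[OF M]) auto
      ultimately show ?thesis
        using finR submatrix_carrier[OF M R q]
        by (simp add: mat_eq_iff_positions pos_in_less_card)
    qed
    show "append_cols (submatrix (Z_AB nx A B2) R s) (submatrix (1\<^sub>m nx) R c)
        = 0\<^sub>m (card R) (card s + card c) \<longleftrightarrow>
      (\<forall>i\<in>R. (\<forall>j\<in>s. Z_AB nx A B2 $$ (i, j) = 0) \<and> (\<forall>k\<in>c. 1\<^sub>m nx $$ (i, k) = (0::tfun)))"
      using append_cols_eq_zero_iff[OF submatrix_carrier[OF Z R s]
          submatrix_carrier[OF one_carrier_mat R c]]
        zero_iff[OF Z s] zero_iff[OF one_carrier_mat c] by blast
  qed
  then show ?thesis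
    unfolding t_set_def by auto
qed

section \<open>Matrices whose rows outside a given set vanish\<close>

text \<open>
  The FIR condition is a condition on each entry separately, since the coefficient matrices can be
  assembled from coefficient sequences chosen per entry.
\<close>

lemma FIR_iff_entries:
  "M \<in> FIR m n T \<longleftrightarrow> M \<in> carrier_mat m n \<and>
    (\<forall>i<m. \<forall>k<n. \<exists>a. M $$ (i, k) = (\<Sum>d\<le>T. inverse z_tf ^ d * const_tf (a d)))"
    (is "_ \<longleftrightarrow> ?R")
proof
  assume "M \<in> FIR m n T"
  then obtain G where "M = mat m n (\<lambda>(r, k). \<Sum>i\<le>T. inverse z_tf ^ i * const_tf (G i $$ (r, k)))"
    unfolding FIR_def by blast
  then show ?R
    by (auto intro: exI[of _ "\<lambda>d. G d $$ (_, _)"])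
next
  assume R: ?R
  then obtain a where a: "M $$ (i, k) = (\<Sum>d\<le>T. inverse z_tf ^ d * const_tf (a i k d))"
    if "i < m" "k < n" for i k
    by metis
  have "M = mat m n (\<lambda>(r, k). \<Sum>d\<le>T. inverse z_tf ^ d *
      const_tf (mat m n (\<lambda>(i, k). a i k d) $$ (r, k)))"
    using R by (intro eq_matI) (auto simp: a)
  then show "M \<in> FIR m n T"
    unfolding FIR_def by (auto intro!: exI[of _ "\<lambda>d. mat m n (\<lambda>(i, k). a i k d)"])
qed

definition zero_rows_outside :: "nat set \<Rightarrow> 'a::zero mat \<Rightarrow> bool" where
  "zero_rows_outside s M \<longleftrightarrow> (\<forall>i<dim_row M. \<forall>k<dim_col M. i \<notin> s \<longrightarrow> M $$ (i, k) = 0)"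

lemma FIR_submatrix_iff:
  assumes M: "M \<in> carrier_mat n m" "zero_rows_outside s M" and s: "s \<subseteq> {..<n}"
  shows "submatrix M s UNIV \<in> FIR (card s) m T \<longleftrightarrow> M \<in> FIR n m T"
proof -
  have fin: "finite s"
    using s finite_subset by auto
  define fir where
    "fir x \<longleftrightarrow> (\<exists>a. x = (\<Sum>d\<le>T. inverse z_tf ^ d * const_tf (a d)))" for x
  have "const_tf 0 = 0"
    by (simp add: const_tf_def fract_collapse)
  then have fir0: "fir 0"
    unfolding fir_def by (intro exI[of _ "\<lambda>_. 0"]) simp
  have "submatrix M s UNIV \<in> FIR (card s) m T \<longleftrightarrow>
      (\<forall>i\<in>s. \<forall>k<m. fir (submatrix M s UNIV $$ (pos_in s i, k)))"
    using submatrix_UNIV_cols_carrier[OF M(1) s] fin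
    by (simp add: FIR_iff_entries all_less_card_iff fir_def)
  also have "\<dots> \<longleftrightarrow> (\<forall>i\<in>s. \<forall>k<m. fir (M $$ (i, k)))"
    using s by (intro ball_cong refl all_cong) (auto simp: index_submatrix_pos_UNIV[OF M(1)])
  also have "\<dots> \<longleftrightarrow> (\<forall>i<n. \<forall>k<m. fir (M $$ (i, k)))"
    using M s fir0 unfolding zero_rows_outside_def by (metis carrier_matD lessThan_iff subsetD)
  also have "\<dots> \<longleftrightarrow> M \<in> FIR n m T"
    using M(1) by (simp add: FIR_iff_entries fir_def)
  finally show ?thesis .
qed

lemma extend_rows_carrier: "M \<in> carrier_mat k m \<Longrightarrow> extend_rows n s M \<in> carrier_mat n m"
  by (simp add: extend_rows_def)

lemma zero_rows_outside_extend_rows: "zero_rows_outside s (extend_rows n s M)"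
  by (simp add: zero_rows_outside_def extend_rows_def)

lemma extend_rows_submatrix:
  assumes "M \<in> carrier_mat n m" "zero_rows_outside s M" "s \<subseteq> {..<n}"
  shows "extend_rows n s (submatrix M s UNIV) = M"
  using assms submatrix_UNIV_cols_carrier[OF assms(1,3)]
  by (intro eq_matI)
    (auto simp: extend_rows_def index_submatrix_pos_UNIV[OF assms(1)] zero_rows_outside_def)

lemma submatrix_extend_rows:
  assumes M: "M \<in> carrier_mat (card s) m" and s: "s \<subseteq> {..<n}"
  shows "submatrix (extend_rows n s M) s UNIV = M"
proof -
  have E: "extend_rows n s M \<in> carrier_mat n m"
    using M by (rule extend_rows_carrier)
  have "submatrix (extend_rows n s M) s UNIV $$ (pos_in s i, l) = M $$ (pos_in s i, l)"
    if "i \<in> s" "l < m" for i l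
  proof -
    have "i < n"
      using that s by auto
    then have "submatrix (extend_rows n s M) s UNIV $$ (pos_in s i, l) = extend_rows n s M $$ (i, l)"
      using that by (intro index_submatrix_pos_UNIV[OF E])
    then show ?thesis
      using \<open>i < n\<close> that M by (simp add: extend_rows_def)
  qed
  moreover have "finite s"
    using s finite_subset by auto
  ultimately show ?thesis
    using mat_eq_iff_row_positions[OF _ submatrix_UNIV_cols_carrier[OF E s] M] by blast
qed

text \<open>The columns of \<open>Z\<close> outside \<open>s\<close> meet zero rows of \<open>M\<close>.\<close>

lemma index_mult_restrict:
  fixes Z M :: "'a::comm_semiring_1 mat"
  assumes Z: "Z \<in> carrier_mat p n" and M: "M \<in> carrier_mat n m" "zero_rows_outside s M"
    and s: "s \<subseteq> {..<n}" and "i < p" "l < m"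
  shows "(Z * M) $$ (i, l) = (\<Sum>j\<in>s. Z $$ (i, j) * M $$ (j, l))"
proof -
  have "(Z * M) $$ (i, l) = (\<Sum>j\<in>{..<n}. Z $$ (i, j) * M $$ (j, l))"
    using assms by (simp add: scalar_prod_def atLeast0LessThan)
  also have "\<dots> = (\<Sum>j\<in>s. Z $$ (i, j) * M $$ (j, l))"
    using M s \<open>l < m\<close> by (intro sum.mono_neutral_right) (auto simp: zero_rows_outside_def)
  finally show ?thesis .
qed

text \<open>
  Both sides are the sum over \<open>s\<close> above: \<open>pos_in s\<close> reindexes the summation in the product of
  the submatrices.
\<close>

lemma index_mult_submatrix:
  fixes Z M :: "'a::comm_semiring_1 mat"
  assumes Z: "Z \<in> carrier_mat p n" and M: "M \<in> carrier_mat n m" "zero_rows_outside s M"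
    and s: "s \<subseteq> {..<n}" and t: "t \<subseteq> {..<p}" and i: "i \<in> t" and l: "l < m"
  shows "(submatrix Z t s * submatrix M s UNIV) $$ (pos_in t i, l) = (Z * M) $$ (i, l)"
proof -
  have fin: "finite s" "finite t"
    using s t finite_subset by auto
  have ip: "i < p"
    using i t by auto
  note Zt = submatrix_carrier[OF Z t s] and Ms = submatrix_UNIV_cols_carrier[OF M(1) s]
  have "(submatrix Z t s * submatrix M s UNIV) $$ (pos_in t i, l)
      = (\<Sum>b\<in>{0..<card s}. submatrix Z t s $$ (pos_in t i, b) * submatrix M s UNIV $$ (b, l))"
    using Zt Ms l pos_in_less_card[OF fin(2) i] by (simp add: scalar_prod_def)
  also have "\<dots> = (\<Sum>j\<in>s. submatrix Z t s $$ (pos_in t i, pos_in s j)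
      * submatrix M s UNIV $$ (pos_in s j, l))"
    by (rule sum.reindex_bij_betw[OF bij_betw_pos_in[OF fin(1)], symmetric])
  also have "\<dots> = (\<Sum>j\<in>s. Z $$ (i, j) * M $$ (j, l))"
    using s ip i l
    by (intro sum.cong refl) (auto simp: index_submatrix_pos[OF Z] index_submatrix_pos_UNIV[OF M(1)])
  also have "\<dots> = (Z * M) $$ (i, l)"
    using index_mult_restrict[OF Z M s ip l] by simp
  finally show ?thesis .
qed

section \<open>The two problems\<close>

lemma opt_value_bij_betw:
  assumes "bij_betw f F F'" "\<And>x. x \<in> F \<Longrightarrow> g' (f x) = g x"
  shows "opt_value g F = opt_value g' F'"
proof -
  have "g' ` F' = g ` F"
    using assms by (force simp: bij_betw_def)
  then show ?thesis
    by (simp add: opt_value_def)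
qed

lemma opt_solutions_bij_betw:
  assumes bij: "bij_betw f F F'" and g: "\<And>x. x \<in> F \<Longrightarrow> g' (f x) = g x"
  shows "bij_betw f (opt_solutions g F) (opt_solutions g' F')"
proof (rule bij_betw_subset[OF bij])
  show "opt_solutions g F \<subseteq> F"
    by (auto simp: opt_solutions_def)
  have F': "F' = f ` F"
    using bij by (simp add: bij_betw_def)
  show "f ` opt_solutions g F = opt_solutions g' F'"
    unfolding F' opt_solutions_def using g by auto
qed

lemma zero_rows_outside_feasible_full:
  assumes c: "finite c" and \<Phi>: "\<Phi> \<in> feasible_full nx nu A B2 c L T X"
  shows "zero_rows_outside (s_set nx nu L c) \<Phi>"
proof -
  have \<Phi>': "\<Phi> \<in> carrier_mat (nx + nu) (card c)"
      "\<forall>i. \<forall>k\<in>c. (i, k) \<in> L \<longrightarrow> \<Phi> $$ (i, pos_in c k) = 0"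
    using \<Phi> by (simp_all add: feasible_full_def sparse_mats_sub_locality_iff)
  have "\<forall>l<card c. \<Phi> $$ (i, l) = 0" if "i < nx + nu" "i \<notin> s_set nx nu L c" for i
    using that \<Phi>'(2) c by (auto simp: all_less_card_iff s_set_eq)
  then show ?thesis
    using \<Phi>'(1) by (auto simp: zero_rows_outside_def)
qed

lemma feasible_full_iff_red:
  assumes AB: "A \<in> carrier_mat nx nx" "B2 \<in> carrier_mat nx nu" and c: "c \<subseteq> {..<nx}"
    and L: "L \<subseteq> {..<nx + nu} \<times> {..<nx}" and s: "s \<subseteq> {..<nx + nu}"
    and \<Phi>: "\<Phi> \<in> carrier_mat (nx + nu) (card c)" "zero_rows_outside s \<Phi>"
  shows "\<Phi> \<in> feasible_full nx nu A B2 c L T X \<longleftrightarrow>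
    submatrix \<Phi> s UNIV \<in> feasible_red nx A B2 s (t_set nx A B2 s c) c L T
      (restrict_set (nx + nu) s (card c) X)"
proof -
  define Z where "Z = Z_AB nx A B2"
  define t where "t = t_set nx A B2 s c"
  define \<Theta> where "\<Theta> = submatrix \<Phi> s UNIV"
  have Z: "Z \<in> carrier_mat nx (nx + nu)"
    unfolding Z_def using AB by (rule Z_AB_carrier)
  have t_eq: "t = {i \<in> {..<nx}.
      \<not> ((\<forall>j\<in>s. Z $$ (i, j) = 0) \<and> (\<forall>k\<in>c. 1\<^sub>m nx $$ (i, k) = (0::tfun)))}"
    unfolding t_def Z_def using AB s c by (rule t_set_eq)
  then have t: "t \<subseteq> {..<nx}"
    by auto
  have fin: "finite s" "finite c" "finite t"
    using finite_subset[OF s] finite_subset[OF c] finite_subset[OF t] by simp_all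
  have \<Theta>: "\<Theta> \<in> carrier_mat (card s) (card c)"
    unfolding \<Theta>_def using \<Phi>(1) s by (rule submatrix_UNIV_cols_carrier)
  have less: "pos_in c k < card c" if "k \<in> c" for k
    using that fin by (simp add: pos_in_less_card)
  have affine: "Z * \<Phi> = submatrix (1\<^sub>m nx) UNIV c \<longleftrightarrow>
      submatrix Z t s * \<Theta> = submatrix (1\<^sub>m nx) t c"
  proof -
    have "Z * \<Phi> = submatrix (1\<^sub>m nx) UNIV c \<longleftrightarrow>
        (\<forall>i<nx. \<forall>k\<in>c. (Z * \<Phi>) $$ (i, pos_in c k) = 1\<^sub>m nx $$ (i, k))"
    proof -
      have "Z * \<Phi> = submatrix (1\<^sub>m nx) UNIV c \<longleftrightarrow>
          (\<forall>i<nx. \<forall>k\<in>c. (Z * \<Phi>) $$ (i, pos_in c k) = submatrix (1\<^sub>m nx) UNIV c $$ (i, pos_in c k))"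
        using mat_eq_iff_positions[of "{..<nx}" c "Z * \<Phi>" "submatrix (1\<^sub>m nx) UNIV c"] fin
          all_less_card_iff[of "{..<nx}"]
          mult_carrier_mat[OF Z \<Phi>(1)] submatrix_UNIV_rows_carrier[OF one_carrier_mat c]
        by simp
      also have "\<dots> \<longleftrightarrow> (\<forall>i<nx. \<forall>k\<in>c. (Z * \<Phi>) $$ (i, pos_in c k) = 1\<^sub>m nx $$ (i, k))"
      proof -
        have "submatrix (1\<^sub>m nx) UNIV c $$ (i, pos_in c k) = (1\<^sub>m nx $$ (i, k) :: tfun)"
          if "i < nx" "k \<in> c" for i k
          using that c index_submatrix_pos[OF one_carrier_mat[of nx], of i k UNIV c] by auto
        then show ?thesis
          by simp
      qed
      finally show ?thesis .
    qed
    \<comment> \<open>outside \<open>t\<close> both sides of the equation vanish\<close>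
    also have "\<dots> \<longleftrightarrow> (\<forall>i\<in>t. \<forall>k\<in>c. (Z * \<Phi>) $$ (i, pos_in c k) = 1\<^sub>m nx $$ (i, k))"
    proof -
      have "(Z * \<Phi>) $$ (i, pos_in c k) = 1\<^sub>m nx $$ (i, k)" if "i < nx" "i \<notin> t" "k \<in> c" for i k
        using that index_mult_restrict[OF Z \<Phi> s that(1) less[OF that(3)]] by (simp add: t_eq)
      then show ?thesis
        using t by blast
    qed
    also have "\<dots> \<longleftrightarrow> (\<forall>i\<in>t. \<forall>k\<in>c. (submatrix Z t s * \<Theta>) $$ (pos_in t i, pos_in c k)
        = submatrix (1\<^sub>m nx) t c $$ (pos_in t i, pos_in c k))"
      unfolding \<Theta>_def
      using c t by (intro ball_cong refl)
        (simp add: index_mult_submatrix[OF Z \<Phi> s t] less subset_iff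
          index_submatrix_pos[OF one_carrier_mat[of nx]])
    also have "\<dots> \<longleftrightarrow> submatrix Z t s * \<Theta> = submatrix (1\<^sub>m nx) t c"
      using mat_eq_iff_positions[OF fin(3,2) mult_carrier_mat[OF submatrix_carrier[OF Z t s] \<Theta>]
          submatrix_carrier[OF one_carrier_mat t c]] by (rule sym)
    finally show ?thesis .
  qed
  have locality: "\<Phi> \<in> sparse_mats (nx + nu) (card c) (sub_locality L UNIV c) \<longleftrightarrow>
      \<Theta> \<in> sparse_mats (card s) (card c) (sub_locality L s c)"
  proof -
    have "\<Theta> $$ (pos_in s i, pos_in c k) = \<Phi> $$ (i, pos_in c k)" if "i \<in> s" "k \<in> c" for i k
      unfolding \<Theta>_def using that s less by (intro index_submatrix_pos_UNIV[OF \<Phi>(1)]) auto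
    moreover have "\<Phi> $$ (i, pos_in c k) = 0" if "i \<notin> s" "(i, k) \<in> L" "k \<in> c" for i k
      using that \<Phi> L less by (auto simp: zero_rows_outside_def)
    ultimately show ?thesis
      using \<Phi>(1) \<Theta> by (auto simp: sparse_mats_sub_locality_iff)
  qed
  have "\<Phi> \<in> X \<longleftrightarrow> \<Theta> \<in> restrict_set (nx + nu) s (card c) X"
    using \<Theta> extend_rows_submatrix[OF \<Phi> s] by (simp add: restrict_set_def \<Theta>_def)
  then show ?thesis
    using \<Phi>(1) \<Theta> affine locality FIR_submatrix_iff[OF \<Phi> s]
    by (simp add: feasible_full_def feasible_red_def flip: Z_def t_def \<Theta>_def)
qed

theorem mainTheorem2:
  fixes nx nu T :: nat
    and A B2 :: "real mat"
    and c :: "nat set"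
    and L :: "(nat \<times> nat) set"
    and g :: "tfun mat \<Rightarrow> ereal"
    and X :: "tfun mat set"
  assumes "A \<in> carrier_mat nx nx"
    and "B2 \<in> carrier_mat nx nu"
    and "c \<subseteq> {..<nx}" and "c \<noteq> {}"
    and "L \<subseteq> {..<nx + nu} \<times> {..<nx}"
    and "X \<subseteq> carrier_mat (nx + nu) (card c)"
  defines "s \<equiv> s_set nx nu L c"
  defines "t \<equiv> t_set nx A B2 s c"
  defines "g' \<equiv> restrict_fun (nx + nu) s g"
  defines "X' \<equiv> restrict_set (nx + nu) s (card c) X"
  defines "F \<equiv> feasible_full nx nu A B2 c L T X"
  defines "F' \<equiv> feasible_red nx A B2 s t c L T X'"
  defines "\<rho> \<equiv> (\<lambda>\<Phi> :: tfun mat. submatrix \<Phi> s UNIV)"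
  shows "bij_betw \<rho> F F' \<and>
    (\<forall>\<Phi>\<in>F. g' (\<rho> \<Phi>) = g \<Phi>) \<and>
    opt_value g F = opt_value g' F' \<and>
    bij_betw \<rho> (opt_solutions g F) (opt_solutions g' F')"
proof -
  have "finite c"
    using \<open>c \<subseteq> {..<nx}\<close> finite_subset by auto
  have s: "s \<subseteq> {..<nx + nu}"
    by (auto simp: s_def s_set_def)
  note iff = feasible_full_iff_red[OF assms(1-3,5) s, of _ T X,
    folded t_def X'_def, folded F_def F'_def]
  have F: "\<Phi> \<in> carrier_mat (nx + nu) (card c)" "zero_rows_outside s \<Phi>" if "\<Phi> \<in> F" for \<Phi>
    using that zero_rows_outside_feasible_full[OF \<open>finite c\<close>]
    by (auto simp: F_def s_def feasible_full_def)
  have F': "\<Theta> \<in> carrier_mat (card s) (card c)" if "\<Theta> \<in> F'" for \<Theta>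
    using that by (auto simp: F'_def feasible_red_def)
  have left_inv: "extend_rows (nx + nu) s (\<rho> \<Phi>) = \<Phi>" if "\<Phi> \<in> F" for \<Phi>
    unfolding \<rho>_def using F[OF that] s by (rule extend_rows_submatrix)
  have right_inv: "\<rho> (extend_rows (nx + nu) s \<Theta>) = \<Theta>" if "\<Theta> \<in> F'" for \<Theta>
    unfolding \<rho>_def using F'[OF that] s by (rule submatrix_extend_rows)
  have "\<rho> \<Phi> \<in> F'" if "\<Phi> \<in> F" for \<Phi>
    using iff[OF F[OF that]] that by (simp add: \<rho>_def)
  moreover have "extend_rows (nx + nu) s \<Theta> \<in> F" if "\<Theta> \<in> F'" for \<Theta>
    using iff[OF extend_rows_carrier[OF F'[OF that]] zero_rows_outside_extend_rows]
      right_inv[OF that] that by (simp add: \<rho>_def)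
  ultimately have bij: "bij_betw \<rho> F F'"
    using left_inv right_inv
    by (intro bij_betw_byWitness[where f' = "extend_rows (nx + nu) s"]) auto
  have obj: "g' (\<rho> \<Phi>) = g \<Phi>" if "\<Phi> \<in> F" for \<Phi>
    using left_inv[OF that] by (simp add: g'_def restrict_fun_def)
  show ?thesis
    using bij obj opt_value_bij_betw[OF bij, of g' g] opt_solutions_bij_betw[OF bij, of g' g]
    by blast
qed

end
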